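(* Let $\mathcal{G}=(V,E)$ be a directed mixed graph, let $O\subseteq V$, and let $\mathcal{M}=m(\mathcal{G},O)$ be the latent projection of $\mathcal{G}$ on $O$. Let $A,B,C\subseteq O$. Then $B$ is $\mu$-separated from $A$ given $C$ in $\mathcal{G}$ if and only if $B$ is $\mu$-separated from $A$ given $C$ in $\mathcal{M}$.
   Context: A directed mixed graph (DMG) $\mathcal{G}=(V,E)$ has a finite node set $V$ and an edge set $E=E_d\sqcup E_b$, where $E_d$ is a set of ordered pairs of nodes (directed edges $\alpha\rightarrow\beta$, with $\alpha=\beta$ allowed) and $E_b$ is a set of unordered pairs (bidirected edges $\alpha\leftrightarrow\beta$, with $\alpha=\beta$ allowed). Several edges may be present between the same two nodes. The edge $\alpha\rightarrow\beta$ has a tail at $\alpha$ and a head at $\beta$; $\alpha\leftrightarrow\beta$ has heads at both ends. Heads and tails are called marks. A walk is a sequence $\langle\gamma_1,e_1,\gamma_2,\ldots,e_n,\gamma_{n+1}\rangle$ with $e_i$ an edge between $\gamma_i$ and $\gamma_{i+1}$, together with an orientation of each directed loop on it (pointing towards $\gamma_1$ or towards $\gamma_{n+1}$); nodes and edges may repeat. It is nontrivial if $n\ge 1$. A non-endpoint occurrence $\gamma_i$ ($1<i<n+1$) is a collider if $e_{i-1}$ and $e_i$ both have heads at that occurrence, and otherwise a noncollider; endpoints are neither. For $C\subseteq V$, $An(C)$ is the set of nodes from which there is a directed path $\gamma\rightarrow\cdots\rightarrow c$ (possibly of length zero) to some $c\in C$; thus $C\subseteq An(C)$. A nontrivial walk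 from $\alpha$ to $\beta$ is $\mu$-connecting given $C$ if $\alpha\notin C$, every collider is in $An(C)$, no noncollider is in $C$, and the last edge has a head at (the final) $\beta$. For $A,B,C\subseteq V$ (not necessarily disjoint), $B$ is $\mu$-separated from $A$ given $C$ if there is no $\mu$-connecting walk from any $\alpha\in A$ to any $\beta\in B$ given $C$. A nontrivial walk between $\alpha$ and $\beta$ is endpoint-identical to an edge $e$ between $\alpha$ and $\beta$ if the first edge of the walk has the same mark at $\alpha$ as $e$ and the last edge of the walk has the same mark at $\beta$ as $e$ (if $\alpha=\beta$ and $e$ is a directed loop, this should hold for one of the two orientations of $e$). Latent projection: for $V=M\sqcup O$, $m(\mathcal{G},O)$ is the DMG with node set $O$ such that an edge $\alpha\sim\beta$ (directed or bidirected, $\alpha,\beta\in O$) is present if and only if there exists in $\mathcal{G}$ a nontrivial walk between $\alpha$ and $\beta$, endpoint-identical to that edge, with no colliders and such that every non-endpoint node is in $M$. *)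

theory Defs
  imports Main "HOL-Library.Uprod"
begin

datatype mark = Head | Tail

datatype 'a edge = Directed 'a 'a | Bidirected "'a uprod"

fun edge_ends :: "'a edge \<Rightarrow> 'a set" where
  "edge_ends (Directed a b) = {a, b}"
| "edge_ends (Bidirected p) = set_uprod p"

record 'a dmg =
  nodes :: "'a set"
  edges :: "'a edge set"

definition directed_mixed_graph :: "'a dmg \<Rightarrow> bool" where
  "directed_mixed_graph G \<longleftrightarrow>
     finite (nodes G) \<and> (\<forall>e\<in>edges G. edge_ends e \<subseteq> nodes G)"

text \<open>
  A step is one edge of a walk together with the node at which it is entered, the node at which
  it is left, and the marks of the edge at these two positions. The marks are determined by the
  other components, except for a directed loop, whose two traversals
  \<open>Step a Tail (Directed a a) Head a\<close> and \<open>Step a Head (Directed a a) Tail a\<close> are exactly its two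
  orientations (pointing towards the end and towards the start of the walk).
\<close>

datatype 'a step =
  Step (src: 'a) (src_mark: mark) (step_edge: "'a edge") (tgt_mark: mark) (tgt: 'a)

inductive traversal :: "'a step \<Rightarrow> bool" where
  forward: "traversal (Step a Tail (Directed a b) Head b)"
| backward: "traversal (Step b Head (Directed a b) Tail a)"
| bidirected: "traversal (Step a Head (Bidirected (Upair a b)) Head b)"

text \<open>
  The list \<open>w\<close> of \<open>n\<close> steps stands for the walk with nodes \<open>\<gamma>\<^sub>1 = src (w ! 0)\<close> and
  \<open>\<gamma>\<^sub>i\<^sub>+\<^sub>2 = tgt (w ! i)\<close> for \<open>i < n\<close>. Hence its non-endpoint occurrences are the \<open>tgt (w ! i)\<close>
  with \<open>Suc i < n\<close>, and the predicates below speak about the occurrence given by such an \<open>i\<close>.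
\<close>

definition nontrivial_walk :: "'a dmg \<Rightarrow> 'a \<Rightarrow> 'a step list \<Rightarrow> 'a \<Rightarrow> bool" where
  "nontrivial_walk G a w b \<longleftrightarrow>
     w \<noteq> [] \<and> src (hd w) = a \<and> tgt (last w) = b \<and>
     (\<forall>s\<in>set w. traversal s \<and> step_edge s \<in> edges G) \<and>
     successively (\<lambda>s t. tgt s = src t) w"

definition collider_at :: "'a step list \<Rightarrow> nat \<Rightarrow> bool" where
  "collider_at w i \<longleftrightarrow>
     Suc i < length w \<and> tgt_mark (w ! i) = Head \<and> src_mark (w ! Suc i) = Head"

definition noncollider_at :: "'a step list \<Rightarrow> nat \<Rightarrow> bool" where
  "noncollider_at w i \<longleftrightarrow> Suc i < length w \<and> \<not> collider_at w i"

definition ancestors :: "'a dmg \<Rightarrow> 'a set \<Rightarrow> 'a set" where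
  "ancestors G C =
     {x \<in> nodes G. \<exists>c\<in>C. (x, c) \<in> {(y, z). Directed y z \<in> edges G}\<^sup>*}"

definition mu_connecting :: "'a dmg \<Rightarrow> 'a set \<Rightarrow> 'a \<Rightarrow> 'a step list \<Rightarrow> 'a \<Rightarrow> bool" where
  "mu_connecting G C a w b \<longleftrightarrow>
     nontrivial_walk G a w b \<and> a \<notin> C \<and>
     (\<forall>i. collider_at w i \<longrightarrow> tgt (w ! i) \<in> ancestors G C) \<and>
     (\<forall>i. noncollider_at w i \<longrightarrow> tgt (w ! i) \<notin> C) \<and>
     tgt_mark (last w) = Head"

text \<open>\<open>mu_separated G A B C\<close>: \<open>B\<close> is \<open>\<mu>\<close>-separated from \<open>A\<close> given \<open>C\<close> (not symmetric in \<open>A\<close>, \<open>B\<close>).\<close>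

definition mu_separated :: "'a dmg \<Rightarrow> 'a set \<Rightarrow> 'a set \<Rightarrow> 'a set \<Rightarrow> bool" where
  "mu_separated G A B C \<longleftrightarrow> \<not> (\<exists>a\<in>A. \<exists>b\<in>B. \<exists>w. mu_connecting G C a w b)"

text \<open>
  The witness \<open>s\<close> is the edge \<open>e\<close> read from the first to the last node of the walk; if \<open>e\<close> is a
  directed loop, this leaves the choice between its two orientations.
\<close>

definition endpoint_identical :: "'a step list \<Rightarrow> 'a edge \<Rightarrow> bool" where
  "endpoint_identical w e \<longleftrightarrow>
     (\<exists>s. traversal s \<and> step_edge s = e \<and>
          src s = src (hd w) \<and> tgt s = tgt (last w) \<and>
          src_mark s = src_mark (hd w) \<and> tgt_mark s = tgt_mark (last w))"

definition latent_projection :: "'a dmg \<Rightarrow> 'a set \<Rightarrow> 'a dmg" where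
  "latent_projection G Ob =
     \<lparr> nodes = Ob,
       edges = {e. edge_ends e \<subseteq> Ob \<and>
         (\<exists>a b w. nontrivial_walk G a w b \<and> endpoint_identical w e \<and>
            (\<forall>i. \<not> collider_at w i) \<and>
            (\<forall>i. Suc i < length w \<longrightarrow> tgt (w ! i) \<in> nodes G - Ob))} \<rparr>"

lemma directed_mixed_graph_latent_projection:
  assumes "directed_mixed_graph G" and "Ob \<subseteq> nodes G"
  shows "directed_mixed_graph (latent_projection G Ob)"
  using assms by (auto simp: directed_mixed_graph_def latent_projection_def intro: finite_subset)

end

theory Submission
  imports Defs
begin

text \<open>
  A walk is condensed to its end points and end marks. In these terms, an edge of the latent
  projection is a collider-free connection of the original graph through unobserved nodes, so
  \<open>\<mu>\<close>-connecting walks of the projection expand by concatenation. Conversely, a collider at an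
  unobserved node \<open>x\<close> is first moved to an observed one by inserting \<open>x \<rightarrow> \<dots> \<rightarrow> d \<leftarrow> \<dots> \<leftarrow> x\<close>, where
  \<open>d\<close> is the first observed node on a directed path from \<open>x\<close> to \<open>C\<close>; then all unobserved occurrences
  are noncolliders, and cutting the walk at its observed nodes yields edges of the projection.
\<close>

section \<open>Walks reduced to end points and end marks\<close>

definition adjacent :: "'a dmg \<Rightarrow> 'a \<Rightarrow> mark \<Rightarrow> mark \<Rightarrow> 'a \<Rightarrow> bool" where
  "adjacent G a m n b \<longleftrightarrow> (\<exists>e\<in>edges G. traversal (Step a m e n b))"

text \<open>\<open>N\<close> holds the allowed noncolliders and \<open>K\<close> the allowed
  colliders. With both as parameters, one relation \<open>connects\<close> serves \<mu>-connection,
  with \<open>- C\<close> and the ancestors of \<open>C\<close>, as well as edges of the projection,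
  with \<open>nodes G - Ob\<close> and \<open>{}\<close>.\<close>

definition passable :: "'a set \<Rightarrow> 'a set \<Rightarrow> mark \<Rightarrow> 'a \<Rightarrow> mark \<Rightarrow> bool" where
  "passable N K p x q \<longleftrightarrow> (if p = Head \<and> q = Head then x \<in> K else x \<in> N)"

inductive connects ::
    "'a dmg \<Rightarrow> 'a set \<Rightarrow> 'a set \<Rightarrow> 'a \<Rightarrow> mark \<Rightarrow> mark \<Rightarrow> 'a \<Rightarrow> bool" for G N K where
  single: "adjacent G a m n b \<Longrightarrow> connects G N K a m n b"
| cons: "adjacent G a m p x \<Longrightarrow> passable N K p x q \<Longrightarrow> connects G N K x q n b \<Longrightarrow>
    connects G N K a m n b"

definition admissible :: "'a set \<Rightarrow> 'a set \<Rightarrow> 'a step list \<Rightarrow> bool" where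
  "admissible N K w \<longleftrightarrow>
     (\<forall>i. collider_at w i \<longrightarrow> tgt (w ! i) \<in> K) \<and> (\<forall>i. noncollider_at w i \<longrightarrow> tgt (w ! i) \<in> N)"

text \<open>Separates index 0, the junction of the first two steps, so that conditions on the
  indices of a walk recurse along its list.\<close>

lemma all_nat_split: "(\<forall>i. P i) \<longleftrightarrow> P 0 \<and> (\<forall>i. P (Suc i))"
  by (metis not0_implies_Suc)

lemma admissible_singleton [simp]: "admissible N K [s]"
  by (simp add: admissible_def collider_at_def noncollider_at_def)

lemma admissible_Cons_Cons [simp]:
  "admissible N K (s # t # w) \<longleftrightarrow>
     passable N K (tgt_mark s) (tgt s) (src_mark t) \<and> admissible N K (t # w)"
  unfolding admissible_def
  by (subst (1 2) all_nat_split) (auto simp: collider_at_def noncollider_at_def passable_def)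

lemma nontrivial_walk_singleton [simp]:
  "nontrivial_walk G a [s] b \<longleftrightarrow>
     src s = a \<and> tgt s = b \<and> traversal s \<and> step_edge s \<in> edges G"
  by (auto simp: nontrivial_walk_def)

lemma nontrivial_walk_Cons_Cons [simp]:
  "nontrivial_walk G a (s # t # w) b \<longleftrightarrow>
     src s = a \<and> traversal s \<and> step_edge s \<in> edges G \<and> nontrivial_walk G (tgt s) (t # w) b"
  by (auto simp: nontrivial_walk_def)

lemma connects_if_walk:
  assumes "nontrivial_walk G a w b" and "admissible N K w"
  shows "connects G N K a (src_mark (hd w)) (tgt_mark (last w)) b"
  using assms
proof (induction w arbitrary: a rule: induct_list012)
  case 1
  then show ?case by (simp add: nontrivial_walk_def)
next
  case (2 s)
  then show ?case by (cases s) (auto intro!: connects.single simp: adjacent_def)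
next
  case (3 s t w)
  from 3 have "connects G N K (tgt s) (src_mark t) (tgt_mark (last (t # w))) b"
    by fastforce
  moreover from 3 have "adjacent G a (src_mark s) (tgt_mark s) (tgt s)"
    by (cases s) (auto simp: adjacent_def)
  ultimately show ?case using 3 by (auto intro: connects.cons)
qed

lemma walk_if_connects:
  assumes "connects G N K a m n b"
  shows "\<exists>w. nontrivial_walk G a w b \<and> admissible N K w \<and>
    src_mark (hd w) = m \<and> tgt_mark (last w) = n"
  using assms
proof induction
  case (single a m n b)
  then obtain e where "e \<in> edges G" "traversal (Step a m e n b)"
    by (auto simp: adjacent_def)
  then show ?case by (intro exI[of _ "[Step a m e n b]"]) simp
next
  case (cons a m p x q n b)
  from cons.hyps obtain e where e: "e \<in> edges G" "traversal (Step a m e p x)"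
    by (auto simp: adjacent_def)
  from cons.IH obtain w where w: "nontrivial_walk G x w b" "admissible N K w"
    "src_mark (hd w) = q" "tgt_mark (last w) = n" by blast
  then obtain t w' where "w = t # w'"
    by (cases w) (auto simp: nontrivial_walk_def)
  with e w cons.hyps show ?case
    by (intro exI[of _ "Step a m e p x # w"]) simp
qed

lemma connects_iff_walk:
  "connects G N K a m n b \<longleftrightarrow> (\<exists>w. nontrivial_walk G a w b \<and> admissible N K w \<and>
    src_mark (hd w) = m \<and> tgt_mark (last w) = n)"
  using connects_if_walk walk_if_connects by metis

lemma mu_connecting_iff_connects:
  "(\<exists>w. mu_connecting G C a w b) \<longleftrightarrow>
     a \<notin> C \<and> (\<exists>m. connects G (- C) (ancestors G C) a m Head b)"
  by (auto simp: mu_connecting_def connects_iff_walk admissible_def)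

section \<open>Monotonicity, concatenation and reversal\<close>

lemma passable_mono:
  "passable N K p x q \<Longrightarrow> N \<subseteq> N' \<Longrightarrow> K \<subseteq> K' \<Longrightarrow> passable N' K' p x q"
  by (auto simp: passable_def split: if_splits)

lemma connects_mono:
  "connects G N K a m n b \<Longrightarrow> N \<subseteq> N' \<Longrightarrow> K \<subseteq> K' \<Longrightarrow> connects G N' K' a m n b"
  by (induction rule: connects.induct) (blast intro: connects.intros passable_mono)+

lemma connects_append:
  "connects G N K a m p x \<Longrightarrow> passable N K p x q \<Longrightarrow> connects G N K x q n b \<Longrightarrow>
   connects G N K a m n b"
  by (induction rule: connects.induct) (auto intro: connects.cons)

lemma traversal_reverse: "traversal (Step a m e n b) \<Longrightarrow> traversal (Step b n e m a)"
  by (auto simp: traversal.simps)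

lemma adjacent_sym: "adjacent G a m n b \<Longrightarrow> adjacent G b n m a"
  unfolding adjacent_def by (blast intro: traversal_reverse)

lemma passable_sym: "passable N K p x q \<Longrightarrow> passable N K q x p"
  by (auto simp: passable_def split: if_splits)

lemma connects_sym: "connects G N K a m n b \<Longrightarrow> connects G N K b n m a"
  by (induction rule: connects.induct)
    (blast intro: connects.single connects_append adjacent_sym passable_sym)+

lemma adjacent_marks: "adjacent G a Tail n b \<Longrightarrow> n = Head"
  by (auto simp: adjacent_def elim: traversal.cases)

text \<open>A step left by a tail arrives with a head. As colliders are excluded, the next step must
  again start with a tail, so the whole walk is a directed path. This rules out tails at both ends,
  the one pair of marks that no edge has.\<close>

lemma collider_free_marks: "connects G N {} a m n b \<Longrightarrow> m = Tail \<Longrightarrow> n = Head"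
proof (induction rule: connects.induct)
  case (cons a m p x q n b)
  then show ?case
    by (cases q) (auto dest: adjacent_marks simp: passable_def)
qed (simp add: adjacent_marks)

section \<open>Edges of the latent projection\<close>

lemma adjacent_nodes:
  "directed_mixed_graph G \<Longrightarrow> adjacent G a m n b \<Longrightarrow> a \<in> nodes G \<and> b \<in> nodes G"
  by (fastforce simp: adjacent_def directed_mixed_graph_def elim: traversal.cases)

lemma traversal_ends: "traversal (Step a m e n b) \<Longrightarrow> edge_ends e = {a, b}"
  by (auto elim: traversal.cases)

lemma traversal_exists: "m = Head \<or> n = Head \<Longrightarrow> \<exists>e. traversal (Step a m e n b)"
  by (cases m; cases n) (auto intro: traversal.intros)

lemma traversal_unique:
  assumes "traversal (Step a m e n b)" and "traversal (Step a' m' e n' b')"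
  shows "a' = a \<and> m' = m \<and> n' = n \<and> b' = b \<or> a' = b \<and> m' = n \<and> n' = m \<and> b' = a"
  using assms by (auto elim!: traversal.cases)

lemma edge_latent_projection_iff:
  "e \<in> edges (latent_projection G Ob) \<longleftrightarrow> edge_ends e \<subseteq> Ob \<and>
     (\<exists>a m n b. traversal (Step a m e n b) \<and> connects G (nodes G - Ob) {} a m n b)"
proof -
  have "(\<forall>i. \<not> collider_at w i) \<and> (\<forall>i. Suc i < length w \<longrightarrow> tgt (w ! i) \<in> nodes G - Ob) \<longleftrightarrow>
      admissible (nodes G - Ob) {} w" for w
    by (auto simp: admissible_def noncollider_at_def)
  moreover have "nontrivial_walk G a w b \<and> endpoint_identical w e \<longleftrightarrow> nontrivial_walk G a w b \<and>
      traversal (Step a (src_mark (hd w)) e (tgt_mark (last w)) b)" for a w b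
  proof -
    have "endpoint_identical w e \<longleftrightarrow>
        traversal (Step (src (hd w)) (src_mark (hd w)) e (tgt_mark (last w)) (tgt (last w)))"
    proof
      assume "endpoint_identical w e"
      then obtain s where "traversal s" "step_edge s = e" "src s = src (hd w)"
        "tgt s = tgt (last w)" "src_mark s = src_mark (hd w)" "tgt_mark s = tgt_mark (last w)"
        unfolding endpoint_identical_def by blast
      \<comment> \<open>The witness is forced: endpoint identity prescribes all five of its
        components.\<close>
      moreover from this have
        "s = Step (src (hd w)) (src_mark (hd w)) e (tgt_mark (last w)) (tgt (last w))"
        by (intro step.expand) simp
      ultimately show
        "traversal (Step (src (hd w)) (src_mark (hd w)) e (tgt_mark (last w)) (tgt (last w)))"
        by simp
    qed (force simp: endpoint_identical_def)
    then show ?thesis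
      by (auto simp: nontrivial_walk_def)
  qed
  ultimately have "e \<in> edges (latent_projection G Ob) \<longleftrightarrow> edge_ends e \<subseteq> Ob \<and>
      (\<exists>a b w. (nontrivial_walk G a w b \<and>
          traversal (Step a (src_mark (hd w)) e (tgt_mark (last w)) b)) \<and>
        admissible (nodes G - Ob) {} w)"
    unfolding latent_projection_def by simp blast
  then show ?thesis
    unfolding connects_iff_walk by blast
qed

text \<open>The walk that puts an edge into the projection may read it in the opposite direction;
  reversing the walk repairs this. Conversely, a collider-free connection never has two tails, so an
  edge with its end marks exists.\<close>

lemma adjacent_latent_projection_iff:
  "adjacent (latent_projection G Ob) a m n b \<longleftrightarrow>
     a \<in> Ob \<and> b \<in> Ob \<and> connects G (nodes G - Ob) {} a m n b" (is "?L \<longleftrightarrow> ?R")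
proof
  assume ?L
  then obtain e a' m' n' b' where e: "traversal (Step a m e n b)" "edge_ends e \<subseteq> Ob"
    "traversal (Step a' m' e n' b')" "connects G (nodes G - Ob) {} a' m' n' b'"
    by (auto simp: adjacent_def edge_latent_projection_iff)
  then show ?R
    using traversal_unique[OF e(1,3)] traversal_ends[OF e(1)] connects_sym[OF e(4)] by auto
next
  assume R: ?R
  then have "m = Head \<or> n = Head"
    by (metis collider_free_marks mark.exhaust)
  then obtain e where e: "traversal (Step a m e n b)"
    using traversal_exists by metis
  with R have "e \<in> edges (latent_projection G Ob)"
    unfolding edge_latent_projection_iff by (auto simp: traversal_ends)
  with e show ?L
    by (auto simp: adjacent_def)
qed

section \<open>Ancestors in the graph and in its projection\<close>

lemma directed_iff_adjacent: "Directed a b \<in> edges G \<longleftrightarrow> adjacent G a Tail Head b"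
  by (auto simp: adjacent_def elim: traversal.cases intro: traversal.intros)

lemma ancestor_adjacent:
  "adjacent G x Tail Head y \<Longrightarrow> x \<in> nodes G \<Longrightarrow> y \<in> ancestors G C \<Longrightarrow> x \<in> ancestors G C"
  unfolding ancestors_def
  by (auto simp: directed_iff_adjacent intro: converse_rtrancl_into_rtrancl)

text \<open>Without colliders, a walk that starts with a tail is a directed path, along which
  ancestry passes backwards.\<close>

lemma collider_free_ancestor:
  assumes "directed_mixed_graph G"
  shows "connects G N {} a m n b \<Longrightarrow> m = Tail \<Longrightarrow> b \<in> ancestors G C \<Longrightarrow> a \<in> ancestors G C"
proof (induction rule: connects.induct)
  case (single a m n b)
  then have "n = Head"
    using adjacent_marks by fast
  with single show ?case
    using adjacent_nodes[OF assms single.hyps] by (blast intro: ancestor_adjacent)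
next
  case (cons a m p x q n b)
  then have "p = Head"
    using adjacent_marks by fast
  with cons.hyps(2) have "q = Tail"
    by (cases q) (auto simp: passable_def)
  with cons \<open>p = Head\<close> show ?case
    using adjacent_nodes[OF assms cons.hyps(1)] by (blast intro: ancestor_adjacent)
qed

lemma ancestors_latent_projection_subset:
  assumes "directed_mixed_graph G" and "Ob \<subseteq> nodes G"
  shows "ancestors (latent_projection G Ob) C \<subseteq> ancestors G C"
proof
  let ?M = "latent_projection G Ob"
  fix x assume "x \<in> ancestors ?M C"
  then obtain c where c: "c \<in> C" "(x, c) \<in> {(y, z). Directed y z \<in> edges ?M}\<^sup>*" and "x \<in> nodes ?M"
    by (auto simp: ancestors_def)
  from c(2) \<open>x \<in> nodes ?M\<close> show "x \<in> ancestors G C"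
  proof (induction rule: converse_rtrancl_induct)
    case base
    then show ?case
      using c(1) assms(2) by (auto simp: ancestors_def latent_projection_def)
  next
    case (step y z)
    then have "connects G (nodes G - Ob) {} y Tail Head z" "z \<in> Ob"
      by (auto simp: directed_iff_adjacent adjacent_latent_projection_iff)
    with step.IH show ?case
      using collider_free_ancestor[OF assms(1)] by (auto simp: latent_projection_def)
  qed
qed

text \<open>Later used in contrapositive form: a node with such a path to \<open>d\<close> that is
  not an ancestor in the projection must be unobserved.\<close>

lemma ancestor_latent_projectionI:
  assumes "x \<in> Ob" and "connects G (nodes G - Ob) {} x Tail Head d"
    and "d \<in> ancestors (latent_projection G Ob) C"
  shows "x \<in> ancestors (latent_projection G Ob) C"
proof (rule ancestor_adjacent)
  show "d \<in> ancestors (latent_projection G Ob) C" by fact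
  have "d \<in> Ob"
    using assms(3) by (auto simp: ancestors_def latent_projection_def)
  with assms show "adjacent (latent_projection G Ob) x Tail Head d"
    by (simp add: adjacent_latent_projection_iff)
  show "x \<in> nodes (latent_projection G Ob)"
    using assms(1) by (simp add: latent_projection_def)
qed

lemma ancestor_reaches_latent_projection:
  assumes "directed_mixed_graph G" and "C \<subseteq> Ob" and "x \<in> ancestors G C"
  shows "x \<in> ancestors (latent_projection G Ob) C \<or>
    (\<exists>d \<in> ancestors (latent_projection G Ob) C. connects G (nodes G - Ob) {} x Tail Head d)"
proof -
  let ?M = "latent_projection G Ob"
  obtain c where c: "c \<in> C" "(x, c) \<in> {(y, z). Directed y z \<in> edges G}\<^sup>*"
    using assms(3) by (auto simp: ancestors_def)
  from c(2) show ?thesis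
  proof (induction rule: converse_rtrancl_induct)
    case base
    then show ?case
      using c(1) assms(2) by (auto simp: ancestors_def latent_projection_def)
  next
    case (step y z)
    then have yz: "adjacent G y Tail Head z"
      by (simp add: directed_iff_adjacent)
    show ?case
    \<comment> \<open>If \<open>z\<close> is an ancestor in the projection, it serves as
      \<open>d\<close>. Otherwise it is unobserved, and the path found from \<open>z\<close> extends
      back to \<open>y\<close>.\<close>
    proof (cases "z \<in> ancestors ?M C")
      case True
      then show ?thesis using yz by (blast intro: connects.single)
    next
      case False
      with step.IH obtain d where d: "d \<in> ancestors ?M C"
        "connects G (nodes G - Ob) {} z Tail Head d" by blast
      with False have "z \<notin> Ob"
        using ancestor_latent_projectionI by metis
      then have "passable (nodes G - Ob) {} Head z Tail"
        using adjacent_nodes[OF assms(1) yz] by (simp add: passable_def)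
      then show ?thesis
        using d connects.cons[OF yz] by blast
    qed
  qed
qed

section \<open>Transfer of connections between the graph and its projection\<close>

lemma connects_observed_colliders:
  assumes G: "directed_mixed_graph G" and C: "C \<subseteq> Ob"
  shows "connects G (- C) (ancestors G C) a m n b \<Longrightarrow>
    connects G (- C) (ancestors (latent_projection G Ob) C) a m n b"
proof (induction rule: connects.induct)
  case (single a m n b)
  then show ?case by (rule connects.single)
next
  case (cons a m p x q n b)
  let ?K = "ancestors (latent_projection G Ob) C"
  show ?case
  proof (cases "passable (- C) ?K p x q")
    case True
    then show ?thesis using cons by (blast intro: connects.cons)
  next
    case False
    with cons.hyps(2) have marks: "p = Head" "q = Head" and x: "x \<in> ancestors G C" "x \<notin> ?K"
      by (auto simp: passable_def split: if_splits)
    then obtain d where d: "d \<in> ?K" "connects G (nodes G - Ob) {} x Tail Head d"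
      using ancestor_reaches_latent_projection[OF G C] by metis
    then have "x \<notin> Ob"
      using x(2) ancestor_latent_projectionI by metis
    \<comment> \<open>Being unobserved, \<open>x\<close> is outside \<open>C\<close> and may be
      passed as a noncollider, once on the way down to \<open>d\<close> and once on return.\<close>
    then have pass: "passable (- C) ?K Head x Tail" "passable (- C) ?K Tail x Head"
      using C by (auto simp: passable_def)
    have down: "connects G (- C) ?K x Tail Head d"
      using d(2) C by (auto intro: connects_mono)
    \<comment> \<open>The way down is followed by its reversal, so two heads meet at
      \<open>d\<close>, the only new collider, which lies in \<open>?K\<close>.\<close>
    have "connects G (- C) ?K x Tail n b"
    proof (rule connects_append[OF down])
      show "passable (- C) ?K Head d Head"
        using d(1) by (simp add: passable_def)
      show "connects G (- C) ?K d Head n b"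
        using connects_append[OF connects_sym[OF down] pass(2)] cons.IH marks by simp
    qed
    then show ?thesis
      using cons.hyps(1) pass(1) marks(1) by (blast intro: connects.cons)
  qed
qed

text \<open>The node \<open>x\<close> is the first observed interior occurrence. The start
  \<open>a\<close> may be unobserved because the induction peels off steps one by one; hence the
  initial piece is kept as a connection in \<open>G\<close> and not yet as an edge of the
  projection.\<close>

lemma connects_cut_at_observed:
  assumes G: "directed_mixed_graph G" and K: "K \<subseteq> Ob"
  shows "connects G N K a m n b \<Longrightarrow> b \<in> Ob \<Longrightarrow>
    connects G (nodes G - Ob) {} a m n b \<or>
    (\<exists>x\<in>Ob. \<exists>p q. connects G (nodes G - Ob) {} a m p x \<and> passable N K p x q \<and>
      connects (latent_projection G Ob) N K x q n b)"
proof (induction rule: connects.induct)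
  case (single a m n b)
  then show ?case by (blast intro: connects.single)
next
  case (cons a m p x q n b)
  show ?case
  proof (cases "x \<in> Ob")
    case True
    \<comment> \<open>From an observed \<open>x\<close>, the initial piece given by the induction
      hypothesis is an edge of the projection.\<close>
    with cons.IH cons.prems have "connects (latent_projection G Ob) N K x q n b"
      by (auto simp: adjacent_latent_projection_iff intro: connects.intros)
    then show ?thesis
      using True cons.hyps by (blast intro: connects.single)
  next
    case False
    \<comment> \<open>As \<open>K\<close> is observed, the unobserved \<open>x\<close> can only be a
      noncollider.\<close>
    then have "passable (nodes G - Ob) {} p x q"
      using cons.hyps(2) K adjacent_nodes[OF G cons.hyps(1)]
      by (auto simp: passable_def split: if_splits)
    then show ?thesis
      using cons.IH[OF cons.prems] cons.hyps(1) by (blast intro: connects.cons)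
  qed
qed

lemma connects_latent_projectionI:
  assumes "directed_mixed_graph G" and "K \<subseteq> Ob" and "a \<in> Ob" and "b \<in> Ob"
    and "connects G N K a m n b"
  shows "connects (latent_projection G Ob) N K a m n b"
  using connects_cut_at_observed[OF assms(1,2,5,4)] assms(3,4)
  by (auto simp: adjacent_latent_projection_iff intro: connects.intros)

text \<open>Each edge expands to a collider-free walk with the same end marks, so occurrences where
  edges meet keep their status, and all new ones are unobserved noncolliders.\<close>

lemma connects_latent_projectionD:
  assumes "nodes G - Ob \<subseteq> N"
  shows "connects (latent_projection G Ob) N K a m n b \<Longrightarrow> connects G N K a m n b"
proof -
  have edge: "connects G N K a m n b" if "adjacent (latent_projection G Ob) a m n b" for a m n b
  proof (rule connects_mono)
    show "connects G (nodes G - Ob) {} a m n b"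
      using that by (simp add: adjacent_latent_projection_iff)
  qed (use assms in auto)
  show "connects (latent_projection G Ob) N K a m n b \<Longrightarrow> connects G N K a m n b"
    by (induction rule: connects.induct) (fact edge, rule connects_append[OF edge])
qed

theorem theorem3p12:
  fixes G :: "'a dmg" and Ob A B C :: "'a set"
  assumes "directed_mixed_graph G"
    and "Ob \<subseteq> nodes G"
    and "A \<subseteq> Ob" and "B \<subseteq> Ob" and "C \<subseteq> Ob"
  shows "mu_separated G A B C \<longleftrightarrow> mu_separated (latent_projection G Ob) A B C"
proof -
  let ?M = "latent_projection G Ob"
  have "connects G (- C) (ancestors G C) a m Head b \<longleftrightarrow>
      connects ?M (- C) (ancestors ?M C) a m Head b" if "a \<in> A" "b \<in> B" for a b m
  proof
    assume "connects G (- C) (ancestors G C) a m Head b"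
    then have "connects G (- C) (ancestors ?M C) a m Head b"
      by (rule connects_observed_colliders[OF assms(1,5)])
    moreover have "ancestors ?M C \<subseteq> Ob"
      by (auto simp: ancestors_def latent_projection_def)
    ultimately show "connects ?M (- C) (ancestors ?M C) a m Head b"
      using connects_latent_projectionI[OF assms(1)] assms(3,4) that by blast
  next
    assume "connects ?M (- C) (ancestors ?M C) a m Head b"
    then have "connects G (- C) (ancestors ?M C) a m Head b"
      using connects_latent_projectionD[of G Ob "- C"] assms(5) by blast
    \<comment> \<open>The expansion keeps the colliders of the projection, whose ancestors of
      \<open>C\<close> are also ancestors in \<open>G\<close>.\<close>
    then show "connects G (- C) (ancestors G C) a m Head b"
      by (rule connects_mono[OF _ subset_refl ancestors_latent_projection_subset[OF assms(1,2)]])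
  qed
  then show ?thesis
    unfolding mu_separated_def mu_connecting_iff_connects by blast
qed

end
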